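(* For every metric space $\mathcal X$ with more than one point, the Steiner–Gromov ratio satisfies $\mathrm{sgr}(\mathcal X)\ge 1/2$. There exist metric spaces whose Steiner–Gromov ratio equals $1/2$.
   Context: A finite graph $G=(V,E)$ joins a finite set $M$ if it is connected and $M\subset V$. For a weight function $\omega:E\to[0,\infty)$, $d_\omega(u,v)$ is the least weight (sum of $\omega$ over edges) of a path in $G$ joining $u$ and $v$, and $\omega(G)=\sum_{e\in E}\omega(e)$. The weighted graph $(G,\omega)$ is a filling of a finite metric space $(M,\rho)$ if $G$ joins $M$ and $\rho(p,q)\le d_\omega(p,q)$ for all $p,q\in M$. $\mathrm{mf}(M,\rho)$ is the infimum of $\omega(G)$ over all fillings of $(M,\rho)$ (over all $G$). $\mathrm{mst}(M,\rho)$ is the length of minimal spanning tree: the minimum, over all trees $T$ with vertex set $M$, of $\sum_{vw\in E(T)}\rho(v,w)$. For a metric space $\mathcal X=(X,\rho)$ and a finite subset $M\subset X$ with more than one point, $\mathrm{sgr}(M)=\mathrm{mf}(M,\rho)/\mathrm{mst}(M,\rho)$. For an integer $n>1$, $\mathrm{sgr}_n(\mathcal X)$ is the infimum of $\mathrm{sgr}(M)$ over all subsets $M\subset X$ with more than one and at most $n$ points. The Steiner–Gromov ratio of $\mathcal X$ is $\mathrm{sgr}(\mathcal X)=\inf_{n>1}\mathrm{sgr}_n(\mathcal X)$. *)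

theory Defs
  imports "HOL-Analysis.Abstract_Metric_Spaces"
begin

text \<open>
  Finite simple undirected graphs are given by a vertex set \<open>V\<close> and a set \<open>E\<close> of
  two-element subsets of \<open>V\<close>.
\<close>

definition finite_graph :: "'v set \<Rightarrow> 'v set set \<Rightarrow> bool" where
  "finite_graph V E \<longleftrightarrow> finite V \<and> (\<forall>e\<in>E. e \<subseteq> V \<and> card e = 2)"

text \<open>A path is the list of its vertices; the singleton list \<open>[u]\<close> is the trivial path at \<open>u\<close>.\<close>

definition is_path :: "'v set \<Rightarrow> 'v set set \<Rightarrow> 'v \<Rightarrow> 'v list \<Rightarrow> 'v \<Rightarrow> bool" where
  "is_path V E u p v \<longleftrightarrow>
     p \<noteq> [] \<and> hd p = u \<and> last p = v \<and> set p \<subseteq> V \<and> distinct p \<and>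
     successively (\<lambda>x y. {x, y} \<in> E) p"

fun path_edges :: "'v list \<Rightarrow> 'v set list" where
  "path_edges (x # y # zs) = {x, y} # path_edges (y # zs)"
| "path_edges _ = []"

definition connected_graph :: "'v set \<Rightarrow> 'v set set \<Rightarrow> bool" where
  "connected_graph V E \<longleftrightarrow> V \<noteq> {} \<and> (\<forall>u\<in>V. \<forall>v\<in>V. \<exists>p. is_path V E u p v)"

definition acyclic_graph :: "'v set \<Rightarrow> 'v set set \<Rightarrow> bool" where
  "acyclic_graph V E \<longleftrightarrow>
     \<not> (\<exists>u v p. is_path V E u p v \<and> length p \<ge> 3 \<and> {v, u} \<in> E)"

definition is_tree :: "'v set \<Rightarrow> 'v set set \<Rightarrow> bool" where
  "is_tree V E \<longleftrightarrow> finite_graph V E \<and> connected_graph V E \<and> acyclic_graph V E"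

text \<open>
  The minimum below is over a finite set, since paths do not repeat vertices; the set is nonempty
  when the graph is connected and contains both endpoints.
\<close>

definition graph_dist :: "'v set \<Rightarrow> 'v set set \<Rightarrow> ('v set \<Rightarrow> real) \<Rightarrow> 'v \<Rightarrow> 'v \<Rightarrow> real" where
  "graph_dist V E \<omega> u v = Min {\<Sum>e\<leftarrow>path_edges p. \<omega> e | p. is_path V E u p v}"

text \<open>
  Besides the points of \<open>M\<close>, a filling may have arbitrarily many further vertices, so its vertices
  are taken from \<open>'a + nat\<close>, with \<open>M\<close> embedded by \<open>Inl\<close>. Up to an isomorphism fixing \<open>M\<close>,
  every finite graph joining a finite set \<open>M\<close> has this form.
\<close>

definition is_filling ::
  "'a set \<Rightarrow> ('a \<Rightarrow> 'a \<Rightarrow> real) \<Rightarrow>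
   ('a + nat) set \<Rightarrow> ('a + nat) set set \<Rightarrow> (('a + nat) set \<Rightarrow> real) \<Rightarrow> bool" where
  "is_filling M \<rho> V E \<omega> \<longleftrightarrow>
     finite_graph V E \<and> connected_graph V E \<and> Inl ` M \<subseteq> V \<and> (\<forall>e\<in>E. 0 \<le> \<omega> e) \<and>
     (\<forall>p\<in>M. \<forall>q\<in>M. \<rho> p q \<le> graph_dist V E \<omega> (Inl p) (Inl q))"

definition mf :: "'a set \<Rightarrow> ('a \<Rightarrow> 'a \<Rightarrow> real) \<Rightarrow> real" where
  "mf M \<rho> = Inf {\<Sum>e\<in>E. \<omega> e | V E \<omega>. is_filling M \<rho> V E \<omega>}"

text \<open>The length of an edge \<open>{v, w}\<close>; well defined because \<open>\<rho>\<close> is symmetric.\<close>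

definition edge_length :: "('a \<Rightarrow> 'a \<Rightarrow> real) \<Rightarrow> 'a set \<Rightarrow> real" where
  "edge_length \<rho> e = (THE r. \<exists>v w. e = {v, w} \<and> r = \<rho> v w)"

definition mst :: "'a set \<Rightarrow> ('a \<Rightarrow> 'a \<Rightarrow> real) \<Rightarrow> real" where
  "mst M \<rho> = Min {\<Sum>e\<in>E. edge_length \<rho> e | E. is_tree M E}"

definition sgr_of_subset :: "('a \<Rightarrow> 'a \<Rightarrow> real) \<Rightarrow> 'a set \<Rightarrow> real" where
  "sgr_of_subset \<rho> M = mf M \<rho> / mst M \<rho>"

text \<open>
  The infima below are real-valued; they range over nonempty sets of nonnegative numbers when
  \<open>n > 1\<close> and \<open>X\<close> has more than one point.
\<close>

definition sgr_n :: "nat \<Rightarrow> 'a set \<Rightarrow> ('a \<Rightarrow> 'a \<Rightarrow> real) \<Rightarrow> real" where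
  "sgr_n n X \<rho> =
     (INF M \<in> {M. M \<subseteq> X \<and> finite M \<and> 1 < card M \<and> card M \<le> n}. sgr_of_subset \<rho> M)"

definition sgr :: "'a set \<Rightarrow> ('a \<Rightarrow> 'a \<Rightarrow> real) \<Rightarrow> real" where
  "sgr X \<rho> = (INF n \<in> {1<..}. sgr_n n X \<rho>)"

end

theory Submission
  imports Defs
begin

text \<open>
  Lower bound. Let \<open>(V, E, \<omega>)\<close> be a filling of \<open>M\<close>. A spanning tree of the connected graph
  \<open>(V, E)\<close> can be traversed by a walk that visits every vertex and uses every tree edge twice, so
  its weight is at most \<open>2 \<cdot> \<omega>(E)\<close> (\<open>leaf_tree_covering_walk\<close>). Joining the points of \<open>M\<close> in the
  order in which the walk meets them gives a tree on \<open>M\<close>; as \<open>\<rho>\<close> is bounded by the graph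
  distance, which is bounded by the weight of the part of the walk in between, this tree is not
  longer than the walk (\<open>walk_gives_tree\<close>). Hence \<open>mst M \<rho> \<le> 2 \<cdot> mf M \<rho>\<close> (\<open>mst_le_2_mf\<close>).

  Sharpness. In the discrete metric on the natural numbers every tree on \<open>n\<close> points has length
  \<open>n - 1\<close>, while the star with one additional centre and all edge weights \<open>1/2\<close> is a filling of
  weight \<open>n/2\<close> (\<open>star_is_filling\<close>). The ratios \<open>n / (2 (n - 1))\<close> tend to \<open>1/2\<close>.
\<close>

section \<open>Trees built by adding leaves\<close>

text \<open>
  Trees in their recursive description: a single vertex is a tree, and joining a new vertex to an
  existing one by an edge preserves trees. All trees constructed below are of this form.
\<close>

inductive leaf_tree :: "'v set \<Rightarrow> 'v set set \<Rightarrow> bool" where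
  single: "leaf_tree {v} {}"
| add_leaf: "leaf_tree V E \<Longrightarrow> x \<in> V \<Longrightarrow> y \<notin> V \<Longrightarrow> leaf_tree (insert y V) (insert {x, y} E)"

lemma leaf_tree_finite_graph:
  assumes "leaf_tree V E"
  shows "finite_graph V E"
  using assms
proof (induction rule: leaf_tree.induct)
  case (single v)
  show ?case by (simp add: finite_graph_def)
next
  case (add_leaf V E x y)
  then show ?case by (auto simp: finite_graph_def card_insert_if)
qed

lemma finite_graph_finite_edges:
  assumes "finite_graph V E"
  shows "finite E"
proof -
  have "E \<subseteq> Pow V" using assms by (auto simp: finite_graph_def)
  moreover have "finite V" using assms by (simp add: finite_graph_def)
  ultimately show ?thesis by (meson finite_Pow_iff finite_subset)
qed

lemma leaf_tree_new_edge:
  assumes "leaf_tree V E" "y \<notin> V"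
  shows "{x, y} \<notin> E"
  using leaf_tree_finite_graph[OF assms(1)] assms(2) by (auto simp: finite_graph_def)

lemma leaf_tree_card:
  assumes "leaf_tree V E"
  shows "card V = card E + 1"
  using assms
proof (induction rule: leaf_tree.induct)
  case (single v)
  show ?case by simp
next
  case (add_leaf V E x y)
  have "finite V" "finite E"
    using leaf_tree_finite_graph[OF add_leaf(1)] finite_graph_finite_edges
    by (auto simp: finite_graph_def)
  then show ?case
    using add_leaf leaf_tree_new_edge[OF add_leaf(1,3)] by simp
qed

lemma is_path_mono:
  assumes "is_path V E u p v" "V \<subseteq> V'" "E \<subseteq> E'"
  shows "is_path V' E' u p v"
  using assms unfolding is_path_def by (auto elim: successively_mono)

lemma leaf_tree_connected:
  assumes "leaf_tree V E"
  shows "connected_graph V E"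
  using assms
proof (induction rule: leaf_tree.induct)
  case (single v)
  have "is_path {v} {} v [v] v" by (simp add: is_path_def)
  then show ?case unfolding connected_graph_def by blast
next
  case (add_leaf V E x y)
  let ?V = "insert y V" and ?E = "insert {x, y} E"
  have old: "\<exists>p. is_path V E u p v" if "u \<in> V" "v \<in> V" for u v
    using add_leaf.IH that by (auto simp: connected_graph_def)
  have "\<exists>p. is_path ?V ?E u p v" if uv: "u \<in> ?V" "v \<in> ?V" for u v
  proof -
    consider "u \<in> V" "v \<in> V" | "u = y" "v = y" | "u = y" "v \<in> V" | "u \<in> V" "v = y"
      using uv by auto
    then show ?thesis
    proof cases
      case 1
      then show ?thesis using old is_path_mono by (metis subset_insertI)
    next
      case 2
      then have "is_path ?V ?E u [y] v" by (simp add: is_path_def)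
      then show ?thesis by blast
    next
      case 3
      obtain p where p: "is_path V E x p v" using old 3 add_leaf by blast
      then have "successively (\<lambda>a b. {a, b} \<in> ?E) p"
        using is_path_mono[OF p, of ?V ?E] by (auto simp: is_path_def)
      then have "is_path ?V ?E u (y # p) v"
        using p 3 add_leaf.hyps by (auto simp: is_path_def successively_Cons insert_commute)
      then show ?thesis by blast
    next
      case 4
      obtain p where p: "is_path V E u p x" using old 4 add_leaf by blast
      then have "successively (\<lambda>a b. {a, b} \<in> ?E) p"
        using is_path_mono[OF p, of ?V ?E] by (auto simp: is_path_def)
      then have "is_path ?V ?E u (p @ [y]) v"
        using p 4 add_leaf.hyps by (auto simp: is_path_def successively_append_iff)
      then show ?thesis by blast
    qed
  qed
  then show ?case unfolding connected_graph_def by blast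
qed

lemma leaf_tree_acyclic:
  assumes "leaf_tree V E"
  shows "acyclic_graph V E"
  using assms
proof (induction rule: leaf_tree.induct)
  case (single v)
  show ?case by (simp add: acyclic_graph_def)
next
  case (add_leaf V E x y)
  let ?V = "insert y V" and ?E = "insert {x, y} E"
  have E: "\<And>e. e \<in> E \<Longrightarrow> e \<subseteq> V"
    using leaf_tree_finite_graph[OF add_leaf(1)] by (auto simp: finite_graph_def)
  have nb: "a = x" if "{a, y} \<in> ?E \<or> {y, a} \<in> ?E" for a
    using that E[of "{a, y}"] E[of "{y, a}"] add_leaf.hyps by (auto simp: doubleton_eq_iff)
  have False if P: "is_path ?V ?E u p v" and len: "length p \<ge> 3" and vu: "{v, u} \<in> ?E" for u v p
  proof (cases "y \<in> set p")
    case False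
    have "u \<noteq> y" "v \<noteq> y" using P False unfolding is_path_def by auto
    then have "{v, u} \<in> E" using vu by (auto simp: doubleton_eq_iff)
    moreover have "is_path V E u p v"
    proof -
      have "successively (\<lambda>a b. {a, b} \<in> E) p"
        by (rule successively_mono[where P = "\<lambda>a b. {a, b} \<in> ?E"])
          (use P False in \<open>auto simp: is_path_def doubleton_eq_iff\<close>)
      then show ?thesis using P False by (auto simp: is_path_def)
    qed
    ultimately show False using add_leaf.IH len unfolding acyclic_graph_def by blast
  next
    case True
    \<comment> \<open>The two cyclic neighbours of \<open>y\<close> on the cycle are distinct, but both must be \<open>x\<close>.\<close>
    then obtain as bs where p: "p = as @ y # bs" by (meson split_list)
    have suc: "successively (\<lambda>a b. {a, b} \<in> ?E) (as @ y # bs)" and dist: "distinct (as @ y # bs)"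
      and hl: "hd (as @ y # bs) = u" "last (as @ y # bs) = v"
      using P p by (auto simp: is_path_def)
    have la: "last as = x" if "as \<noteq> []"
      using suc that nb by (auto simp: successively_append_iff)
    have hb: "hd bs = x" if "bs \<noteq> []"
      using suc that nb by (auto simp: successively_append_iff successively_Cons)
    consider "as = []" | "as \<noteq> []" "bs = []" | "as \<noteq> []" "bs \<noteq> []" by blast
    then show False
    proof cases
      case 1
      then obtain b c cs where bs: "bs = b # c # cs"
        using len p by (cases bs; cases "tl bs") auto
      have "v = x" using vu hl 1 nb by auto
      then have "last (c # cs) = b" using hl bs hb 1 by auto
      then have "b \<in> set (c # cs)" by (metis last_in_set list.distinct(1))
      then show False using dist 1 bs by auto
    next
      case 2
      then obtain a cs where as: "as = a # cs" "cs \<noteq> []"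
        using len p by (cases as; cases "tl as") auto
      have "u = x" using vu hl 2 nb by auto
      then have "last cs = a" using hl as la by auto
      then have "a \<in> set cs" using as by auto
      then show False using dist as by auto
    next
      case 3
      then have "x \<in> set as" "x \<in> set bs" using la hb by (metis last_in_set, metis hd_in_set)
      then show False using dist by auto
    qed
  qed
  then show ?case unfolding acyclic_graph_def by blast
qed

lemma leaf_tree_is_tree:
  assumes "leaf_tree V E"
  shows "is_tree V E"
  using assms by (simp add: is_tree_def leaf_tree_finite_graph leaf_tree_connected leaf_tree_acyclic)

lemma successively_crossing:
  assumes "successively R p" "p \<noteq> []" "hd p \<in> S" "last p \<notin> S"
  shows "\<exists>x\<in>set p \<inter> S. \<exists>y\<in>set p - S. R x y"
  using assms
proof (induction p)
  case Nil
  then show ?case by simp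
next
  case (Cons a p)
  show ?case
  proof (cases "p = []")
    case True
    then show ?thesis using Cons by simp
  next
    case False
    show ?thesis
    proof (cases "hd p \<in> S")
      case True
      then show ?thesis using Cons False by (fastforce simp: successively_Cons)
    next
      case f: False
      then show ?thesis using Cons False hd_in_set[OF False] by (auto simp: successively_Cons)
    qed
  qed
qed

text \<open>A tree that misses a vertex is enlarged along an edge leaving its vertex set.\<close>

lemma connected_graph_spanning_leaf_tree:
  assumes "finite V" "connected_graph V E"
  shows "\<exists>F\<subseteq>E. leaf_tree V F"
proof -
  have grow: "\<exists>F\<subseteq>E. leaf_tree V F"
    if "leaf_tree S F" "S \<subseteq> V" "F \<subseteq> E" for S F
    using that
  proof (induction "card (V - S)" arbitrary: S F rule: less_induct)
    case less
    show ?case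
    proof (cases "S = V")
      case True
      then show ?thesis using less by blast
    next
      case False
      then obtain v where v: "v \<in> V" "v \<notin> S" using less by blast
      obtain u where u: "u \<in> S"
        using less.prems(1) by (auto elim: leaf_tree.cases)
      obtain p where p: "is_path V E u p v"
        using assms(2) u v less.prems(2) unfolding connected_graph_def by blast
      obtain x y where xy: "x \<in> S" "y \<in> set p" "y \<notin> S" "{x, y} \<in> E"
        using successively_crossing[of "\<lambda>x y. {x, y} \<in> E" p S] p u v by (auto simp: is_path_def)
      have yV: "y \<in> V" using p xy by (auto simp: is_path_def)
      have "card (V - insert y S) < card (V - S)"
        using yV xy assms(1) by (intro psubset_card_mono) auto
      then show ?thesis
        using less.hyps[of "insert y S" "insert {x, y} F"] leaf_tree.add_leaf[of S F x y]
          less.prems xy yV by auto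
    qed
  qed
  obtain v where "v \<in> V" using assms(2) by (auto simp: connected_graph_def)
  then show ?thesis using grow[OF leaf_tree.single[of v]] by simp
qed

section \<open>Walks and the graph distance\<close>

text \<open>The weight of any vertex list, so also of a walk; an edge counts as often as it is traversed.\<close>

abbreviation path_weight :: "('v set \<Rightarrow> real) \<Rightarrow> 'v list \<Rightarrow> real" where
  "path_weight \<omega> p \<equiv> (\<Sum>e\<leftarrow>path_edges p. \<omega> e)"

lemma path_edges_append:
  "path_edges (p @ x # q) = path_edges (p @ [x]) @ path_edges (x # q)"
  by (induction p rule: path_edges.induct) auto

lemma set_path_edges:
  assumes "successively (\<lambda>x y. {x, y} \<in> E) p"
  shows "set (path_edges p) \<subseteq> E"
  using assms by (induction p rule: path_edges.induct) auto

lemma path_weight_nonneg: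
  assumes "successively (\<lambda>x y. {x, y} \<in> E) p" "\<forall>e\<in>E. 0 \<le> \<omega> e"
  shows "0 \<le> path_weight \<omega> p"
  using set_path_edges[OF assms(1)] assms(2) by (intro sum_list_nonneg) auto

text \<open>The walk is modified at \<open>x\<close> by the detour \<open>x, y, x\<close> whenever a leaf \<open>y\<close> is attached to \<open>x\<close>.\<close>

lemma leaf_tree_covering_walk:
  assumes "leaf_tree V F"
  shows "\<exists>ws. ws \<noteq> [] \<and> set ws = V \<and> successively (\<lambda>x y. {x, y} \<in> F) ws \<and>
           path_weight \<omega> ws = 2 * (\<Sum>e\<in>F. \<omega> e)"
  using assms
proof (induction rule: leaf_tree.induct)
  case (single v)
  show ?case by (rule exI[of _ "[v]"]) simp
next
  case (add_leaf V F x y)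
  obtain ws where ws: "set ws = V" "successively (\<lambda>x y. {x, y} \<in> F) ws"
    "path_weight \<omega> ws = 2 * (\<Sum>e\<in>F. \<omega> e)"
    using add_leaf.IH by blast
  obtain as bs where wsd: "ws = as @ x # bs" using ws(1) add_leaf.hyps(2) by (meson split_list)
  let ?F = "insert {x, y} F" and ?ws = "as @ x # y # x # bs"
  have "finite F" using leaf_tree_finite_graph[OF add_leaf(1)] finite_graph_finite_edges by blast
  then have "(\<Sum>e\<in>?F. \<omega> e) = \<omega> {x, y} + (\<Sum>e\<in>F. \<omega> e)"
    using leaf_tree_new_edge[OF add_leaf(1,3)] by simp
  moreover have "path_weight \<omega> ?ws = path_weight \<omega> ws + 2 * \<omega> {x, y}"
    unfolding wsd path_edges_append[of as x "y # x # bs"] path_edges_append[of as x bs]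
    by (simp add: insert_commute)
  moreover have "successively (\<lambda>x y. {x, y} \<in> ?F) ?ws"
  proof -
    have "successively (\<lambda>x y. {x, y} \<in> ?F) ws"
      using ws(2) by (rule successively_mono) auto
    then show ?thesis
      unfolding wsd by (auto simp: successively_append_iff successively_Cons insert_commute)
  qed
  moreover have "set ?ws = insert y V" using ws(1) wsd by auto
  ultimately show ?case using ws(3) by (intro exI[of _ ?ws]) auto
qed

lemma finite_path_weights:
  assumes "finite V"
  shows "finite {path_weight \<omega> p | p. is_path V E u p v}"
proof -
  have "{p. is_path V E u p v} \<subseteq> {p. set p \<subseteq> V \<and> distinct p}"
    by (auto simp: is_path_def)
  then have "finite {p. is_path V E u p v}"
    using finite_subset_distinct[OF assms] finite_subset by blast
  then show ?thesis by (simp add: setcompr_eq_image)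
qed

lemma graph_dist_le:
  assumes "finite V" "is_path V E u p v"
  shows "graph_dist V E \<omega> u v \<le> path_weight \<omega> p"
  unfolding graph_dist_def using assms by (intro Min_le finite_path_weights) auto

lemma graph_dist_attained:
  assumes "finite V" "connected_graph V E" "u \<in> V" "v \<in> V"
  shows "\<exists>p. is_path V E u p v \<and> graph_dist V E \<omega> u v = path_weight \<omega> p"
proof -
  have "{path_weight \<omega> p | p. is_path V E u p v} \<noteq> {}"
    using assms by (auto simp: connected_graph_def)
  from Min_in[OF finite_path_weights[OF assms(1)] this]
  show ?thesis unfolding graph_dist_def by auto
qed

text \<open>
  If \<open>u\<close> lies on a shortest path from \<open>v\<close> to \<open>w\<close>, prepending \<open>u\<close> does not give a path; the part of
  the shortest path from \<open>u\<close> on is used then.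
\<close>

lemma graph_dist_step:
  assumes "finite V" "connected_graph V E" "u \<in> V" "v \<in> V" "w \<in> V" "{u, v} \<in> E"
    and pos: "\<forall>e\<in>E. 0 \<le> \<omega> e"
  shows "graph_dist V E \<omega> u w \<le> \<omega> {u, v} + graph_dist V E \<omega> v w"
proof -
  obtain p where p: "is_path V E v p w" "graph_dist V E \<omega> v w = path_weight \<omega> p"
    using graph_dist_attained[OF assms(1,2,4,5)] by blast
  show ?thesis
  proof (cases "u \<in> set p")
    case False
    have "is_path V E u (u # p) w"
      using p(1) False assms by (auto simp: is_path_def successively_Cons)
    moreover have "path_weight \<omega> (u # p) = \<omega> {u, v} + path_weight \<omega> p"
      using p(1) by (cases p) (auto simp: is_path_def)
    ultimately show ?thesis using graph_dist_le[OF assms(1)] p(2) by metis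
  next
    case True
    then obtain as bs where pd: "p = as @ u # bs" by (meson split_list)
    have suc: "successively (\<lambda>x y. {x, y} \<in> E) (as @ [u])"
      using p(1) unfolding pd is_path_def by (auto simp: successively_append_iff)
    have "is_path V E u (u # bs) w"
      using p(1) unfolding pd is_path_def by (auto simp: successively_append_iff)
    then have "graph_dist V E \<omega> u w \<le> path_weight \<omega> (u # bs)"
      by (rule graph_dist_le[OF assms(1)])
    also have "\<dots> \<le> path_weight \<omega> p"
      unfolding pd path_edges_append[of as u bs] using path_weight_nonneg[OF suc pos] by simp
    finally show ?thesis using p(2) pos assms(6) by force
  qed
qed

lemma graph_dist_self_le:
  assumes "finite V" "u \<in> V"
  shows "graph_dist V E \<omega> u u \<le> 0"
  using graph_dist_le[OF assms(1), of E u "[u]" u \<omega>] assms(2) by (simp add: is_path_def)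

section \<open>Fillings and spanning trees\<close>

lemma edge_length_doubleton:
  assumes "\<And>x y. \<rho> x y = \<rho> y x"
  shows "edge_length \<rho> {v, w} = \<rho> v w"
  unfolding edge_length_def
proof (rule the_equality)
  show "\<exists>v' w'. {v, w} = {v', w'} \<and> \<rho> v w = \<rho> v' w'" by blast
next
  fix r
  assume "\<exists>v' w'. {v, w} = {v', w'} \<and> r = \<rho> v' w'"
  then show "r = \<rho> v w" using assms by (auto simp: doubleton_eq_iff)
qed

lemma finite_tree_lengths:
  assumes "finite M"
  shows "finite {\<Sum>e\<in>E. edge_length \<rho> e | E. is_tree M E}"
proof -
  have "{E. is_tree M E} \<subseteq> Pow (Pow M)" by (auto simp: is_tree_def finite_graph_def)
  then have "finite {E. is_tree M E}" using assms by (meson finite_Pow_iff finite_subset)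
  then show ?thesis by (simp add: setcompr_eq_image)
qed

text \<open>
  Reading the walk backwards, the points of \<open>M\<close> met so far carry a tree; the distance from the
  current position to the most recently attached point \<open>p\<close> is paid for by the walk since then.
\<close>

lemma walk_gives_tree:
  assumes sym: "\<And>x y. \<rho> x y = \<rho> y x"
    and fill: "is_filling M \<rho> V E \<omega>"
    and "ws \<noteq> []" "set ws \<subseteq> V" "successively (\<lambda>x y. {x, y} \<in> E) ws"
    and "{m \<in> M. Inl m \<in> set ws} \<noteq> {}"
  shows "\<exists>T p. leaf_tree {m \<in> M. Inl m \<in> set ws} T \<and> p \<in> M \<and> Inl p \<in> set ws \<and>
           (\<Sum>e\<in>T. edge_length \<rho> e) + graph_dist V E \<omega> (hd ws) (Inl p) \<le> path_weight \<omega> ws"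
  using assms(3-)
proof (induction ws)
  case Nil
  then show ?case by simp
next
  case (Cons u ws)
  let ?M = "\<lambda>ws. {m \<in> M. Inl m \<in> set ws}" and ?D = "graph_dist V E \<omega>"
  have V: "finite V" "connected_graph V E" and pos: "\<forall>e\<in>E. 0 \<le> \<omega> e"
    and \<rho>D: "\<And>p q. p \<in> M \<Longrightarrow> q \<in> M \<Longrightarrow> \<rho> p q \<le> ?D (Inl p) (Inl q)"
    using fill by (auto simp: is_filling_def finite_graph_def)
  have uV: "u \<in> V" using Cons.prems by simp
  have D0: "?D u u \<le> 0" by (rule graph_dist_self_le[OF V(1) uV])
  show ?case
  proof (cases "?M ws = {}")
    case True
    then obtain m where m: "m \<in> M" "u = Inl m" using Cons.prems(4) by auto
    have "?M (u # ws) = {m}" using True m by auto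
    then have "leaf_tree (?M (u # ws)) {}" using leaf_tree.single by metis
    moreover have "0 \<le> path_weight \<omega> (u # ws)"
      using path_weight_nonneg[OF Cons.prems(3) pos] .
    ultimately show ?thesis using m D0 by (intro exI[of _ "{}"] exI[of _ m]) auto
  next
    case False
    then have ne: "ws \<noteq> []" by auto
    then have suc: "successively (\<lambda>x y. {x, y} \<in> E) ws" and edge: "{u, hd ws} \<in> E"
      using Cons.prems by (auto simp: successively_Cons)
    obtain T p where T: "leaf_tree (?M ws) T" "p \<in> M" "Inl p \<in> set ws"
      "(\<Sum>e\<in>T. edge_length \<rho> e) + ?D (hd ws) (Inl p) \<le> path_weight \<omega> ws"
      using Cons.IH[OF ne _ suc False] Cons.prems(2) by auto
    have "path_weight \<omega> (u # ws) = \<omega> {u, hd ws} + path_weight \<omega> ws"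
      using ne by (cases ws) auto
    moreover have "?D u (Inl p) \<le> \<omega> {u, hd ws} + ?D (hd ws) (Inl p)"
      using Cons.prems(2) ne T(3) edge pos
      by (intro graph_dist_step[OF V]) auto
    ultimately have le: "(\<Sum>e\<in>T. edge_length \<rho> e) + ?D u (Inl p) \<le> path_weight \<omega> (u # ws)"
      using T(4) by linarith
    show ?thesis
    proof (cases "\<exists>m\<in>M. u = Inl m \<and> Inl m \<notin> set ws")
      case True
      then obtain m where m: "m \<in> M" "u = Inl m" "Inl m \<notin> set ws" by blast
      have "finite T" using leaf_tree_finite_graph[OF T(1)] finite_graph_finite_edges by blast
      moreover have "{p, m} \<notin> T" using leaf_tree_new_edge[OF T(1)] m by simp
      moreover have "edge_length \<rho> {p, m} = \<rho> m p"
        using edge_length_doubleton[of \<rho>, OF sym] sym by metis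
      ultimately have "(\<Sum>e\<in>insert {p, m} T. edge_length \<rho> e) + ?D u (Inl m)
          \<le> path_weight \<omega> (u # ws)"
        using le D0 \<rho>D[OF m(1) T(2)] m(2) by simp
      moreover have "?M (u # ws) = insert m (?M ws)" using m by auto
      then have "leaf_tree (?M (u # ws)) (insert {p, m} T)"
        using leaf_tree.add_leaf[OF T(1), of p m] T m by simp
      ultimately show ?thesis using m by (intro exI[of _ "insert {p, m} T"] exI[of _ m]) auto
    next
      case False
      then have "?M (u # ws) = ?M ws" by auto
      then show ?thesis using T le by (intro exI[of _ T] exI[of _ p]) auto
    qed
  qed
qed

lemma mst_le_2_filling:
  assumes sym: "\<And>x y. \<rho> x y = \<rho> y x" and M: "finite M" "M \<noteq> {}"
    and fill: "is_filling M \<rho> V E \<omega>"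
  shows "mst M \<rho> \<le> 2 * (\<Sum>e\<in>E. \<omega> e)"
proof -
  have V: "finite V" "finite E" "connected_graph V E" and pos: "\<forall>e\<in>E. 0 \<le> \<omega> e"
    and MV: "Inl ` M \<subseteq> V"
    using fill finite_graph_finite_edges by (auto simp: is_filling_def finite_graph_def)
  obtain F where F: "F \<subseteq> E" "leaf_tree V F"
    using connected_graph_spanning_leaf_tree[OF V(1,3)] by blast
  obtain ws where ws: "ws \<noteq> []" "set ws = V" "successively (\<lambda>x y. {x, y} \<in> F) ws"
    "path_weight \<omega> ws = 2 * (\<Sum>e\<in>F. \<omega> e)"
    using leaf_tree_covering_walk[OF F(2)] by blast
  have suc: "successively (\<lambda>x y. {x, y} \<in> E) ws"
    using ws(3) F(1) by (auto elim: successively_mono)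
  have eq: "{m \<in> M. Inl m \<in> set ws} = M" using MV ws(2) by auto
  obtain T p where T: "leaf_tree M T" "p \<in> M"
    "(\<Sum>e\<in>T. edge_length \<rho> e) + graph_dist V E \<omega> (hd ws) (Inl p) \<le> path_weight \<omega> ws"
    using walk_gives_tree[OF sym fill ws(1) _ suc] eq M(2) ws(2) by auto
  have "hd ws \<in> V" using ws(1,2) by auto
  then obtain q where q: "is_path V E (hd ws) q (Inl p)"
    "graph_dist V E \<omega> (hd ws) (Inl p) = path_weight \<omega> q"
    using graph_dist_attained[OF V(1,3)] T(2) MV by blast
  have "0 \<le> path_weight \<omega> q"
    using q(1) pos by (intro path_weight_nonneg) (auto simp: is_path_def)
  moreover have "mst M \<rho> \<le> (\<Sum>e\<in>T. edge_length \<rho> e)"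
    unfolding mst_def using leaf_tree_is_tree[OF T(1)]
    by (intro Min_le finite_tree_lengths M) auto
  moreover have "(\<Sum>e\<in>F. \<omega> e) \<le> (\<Sum>e\<in>E. \<omega> e)"
    using F(1) V(2) pos by (intro sum_mono2) auto
  ultimately show ?thesis using T(3) ws(4) q(2) by linarith
qed

section \<open>Star fillings\<close>

lemma star_leaf_tree:
  assumes "finite A" "c \<notin> A"
  shows "leaf_tree (insert c A) ((\<lambda>a. {c, a}) ` A)"
  using assms
proof (induction rule: finite_induct)
  case empty
  then show ?case by (simp add: leaf_tree.single)
next
  case (insert a A)
  then have "leaf_tree (insert a (insert c A)) (insert {c, a} ((\<lambda>a. {c, a}) ` A))"
    by (intro leaf_tree.add_leaf) auto
  then show ?case by (simp add: insert_commute)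
qed

lemma path_weight_const:
  "path_weight (\<lambda>_. c) p = c * real (length p - 1)"
  by (induction p rule: path_edges.induct) (auto simp: algebra_simps)

lemma star_is_filling:
  fixes M :: "'a set"
  assumes M: "finite M" and c: "0 \<le> c"
    and diag: "\<And>p. p \<in> M \<Longrightarrow> \<rho> p p \<le> 0"
    and bound: "\<And>p q. p \<in> M \<Longrightarrow> q \<in> M \<Longrightarrow> \<rho> p q \<le> 2 * c"
  shows "\<exists>V E. is_filling M \<rho> V E (\<lambda>_. c) \<and> (\<Sum>e\<in>E. c) = c * card M"
proof -
  define A :: "('a + nat) set" where "A = Inl ` M"
  let ?z = "Inr 0 :: 'a + nat"
  let ?V = "insert ?z A" and ?E = "(\<lambda>a. {?z, a}) ` A"
  have A: "finite A" "?z \<notin> A" "card A = card M"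
    using M by (auto simp: A_def card_image)
  have lt: "leaf_tree ?V ?E" by (rule star_leaf_tree[OF A(1,2)])
  have conn: "connected_graph ?V ?E" using leaf_tree_connected[OF lt] .
  have "\<rho> p q \<le> graph_dist ?V ?E (\<lambda>_. c) (Inl p) (Inl q)" if pq: "p \<in> M" "q \<in> M" for p q
  proof -
    have pqV: "Inl p \<in> ?V" "Inl q \<in> ?V" and finV: "finite ?V" using pq A(1) by (auto simp: A_def)
    obtain r where r: "is_path ?V ?E (Inl p) r (Inl q)"
      "graph_dist ?V ?E (\<lambda>_. c) (Inl p) (Inl q) = path_weight (\<lambda>_. c) r"
      using graph_dist_attained[OF finV conn pqV] by blast
    show ?thesis
    proof (cases "p = q")
      case True
      then show ?thesis using r(2) diag[OF pq(1)] c unfolding path_weight_const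
        by (smt (verit) mult_nonneg_nonneg of_nat_0_le_iff)
    next
      case False
      \<comment> \<open>No edge joins two points of \<open>M\<close>, so a path between them has at least two edges.\<close>
      have "length r \<ge> 3"
      proof (rule ccontr)
        assume "\<not> length r \<ge> 3"
        then consider "r = []" | x where "r = [x]" | x y where "r = [x, y]"
          by (cases r; cases "tl r"; cases "tl (tl r)") auto
        then show False
          using r(1) False A(2) by cases (auto simp: is_path_def doubleton_eq_iff)
      qed
      then have "2 * c \<le> c * real (length r - 1)"
        using c by (subst mult.commute) (intro mult_left_mono, auto)
      then show ?thesis using r(2) bound[OF pq] unfolding path_weight_const by linarith
    qed
  qed
  then have "is_filling M \<rho> ?V ?E (\<lambda>_. c)"
    using leaf_tree_finite_graph[OF lt] conn c by (auto simp: is_filling_def A_def)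
  moreover have "card ?E = card M"
    using leaf_tree_card[OF lt] A by simp
  ultimately show ?thesis by (intro exI[of _ ?V] exI[of _ ?E]) (simp add: mult.commute)
qed

lemma filling_exists:
  assumes "finite M" "\<And>p. p \<in> M \<Longrightarrow> \<rho> p p = 0"
  shows "\<exists>V E \<omega>. is_filling M \<rho> V E \<omega>"
proof -
  define c where "c = Max (insert 0 ((\<lambda>(p, q). \<rho> p q) ` (M \<times> M)))"
  have fin: "finite (insert 0 ((\<lambda>(p, q). \<rho> p q) ` (M \<times> M)))" using assms(1) by simp
  have "0 \<le> c" unfolding c_def using fin by (intro Max_ge) auto
  moreover have "\<rho> p q \<le> c" if "p \<in> M" "q \<in> M" for p q
    unfolding c_def using fin that by (intro Max_ge) auto
  ultimately show ?thesis
    using star_is_filling[OF assms(1), of c \<rho>] assms(2) by fastforce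
qed

section \<open>The ratio of a finite set\<close>

lemma mst_attained:
  assumes "finite M" "M \<noteq> {}"
  shows "\<exists>E. is_tree M E \<and> mst M \<rho> = (\<Sum>e\<in>E. edge_length \<rho> e)"
proof -
  obtain a where "a \<in> M" using assms(2) by blast
  then have "leaf_tree M ((\<lambda>b. {a, b}) ` (M - {a}))"
    using star_leaf_tree[of "M - {a}" a] assms(1) by (simp add: insert_absorb)
  then have "{\<Sum>e\<in>E. edge_length \<rho> e | E. is_tree M E} \<noteq> {}"
    using leaf_tree_is_tree by blast
  from Min_in[OF finite_tree_lengths[OF assms(1)] this]
  show ?thesis unfolding mst_def by auto
qed

lemma tree_card_ge:
  assumes "is_tree M E"
  shows "card M \<le> card E + 1"
proof -
  have *: "finite M" "finite E" "connected_graph M E"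
    using assms finite_graph_finite_edges by (auto simp: is_tree_def finite_graph_def)
  then obtain F where "F \<subseteq> E" "leaf_tree M F" using connected_graph_spanning_leaf_tree by blast
  then show ?thesis using leaf_tree_card[of M F] card_mono[OF *(2)] by simp
qed

lemma tree_edge:
  assumes "is_tree M E" "e \<in> E"
  shows "\<exists>v\<in>M. \<exists>w\<in>M. v \<noteq> w \<and> e = {v, w}"
proof -
  have "e \<subseteq> M" "card e = 2" using assms by (auto simp: is_tree_def finite_graph_def)
  then show ?thesis by (auto simp: card_2_iff)
qed

lemma mst_pos:
  assumes "Metric_space X \<rho>" "M \<subseteq> X" "finite M" "1 < card M"
  shows "0 < mst M \<rho>"
proof -
  interpret Metric_space X \<rho> by fact
  have "M \<noteq> {}" using assms(4) by auto
  then obtain E where E: "is_tree M E" "mst M \<rho> = (\<Sum>e\<in>E. edge_length \<rho> e)"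
    using mst_attained[OF assms(3)] by blast
  have "finite E" using E(1) finite_graph_finite_edges by (auto simp: is_tree_def)
  moreover have "E \<noteq> {}" using tree_card_ge[OF E(1)] assms(4) by auto
  moreover have "0 < edge_length \<rho> e" if e: "e \<in> E" for e
  proof -
    obtain v w where vw: "e = {v, w}" "v \<in> M" "w \<in> M" "v \<noteq> w"
      using tree_edge[OF E(1) e] by blast
    then have "0 < \<rho> v w" using assms(2) mdist_pos_less by blast
    then show ?thesis using edge_length_doubleton[of \<rho>, OF commute] vw(1) by metis
  qed
  ultimately show ?thesis unfolding E(2) by (intro sum_pos) auto
qed

lemma mst_le_2_mf:
  assumes "Metric_space X \<rho>" "M \<subseteq> X" "finite M" "M \<noteq> {}"
  shows "mst M \<rho> \<le> 2 * mf M \<rho>"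
proof -
  interpret Metric_space X \<rho> by fact
  have "\<exists>V E \<omega>. is_filling M \<rho> V E \<omega>"
  proof (rule filling_exists[OF assms(3)])
    show "\<rho> p p = 0" if "p \<in> M" for p using that assms(2) by auto
  qed
  then have "mst M \<rho> / 2 \<le> mf M \<rho>"
    unfolding mf_def using mst_le_2_filling[of \<rho>, OF commute assms(3,4)]
    by (intro cInf_greatest) (auto simp: field_simps)
  then show ?thesis by simp
qed

lemma sgr_of_subset_ge_half:
  assumes "Metric_space X \<rho>" "M \<subseteq> X" "finite M" "1 < card M"
  shows "1 / 2 \<le> sgr_of_subset \<rho> M"
proof -
  have "M \<noteq> {}" using assms(4) by auto
  then have "mst M \<rho> \<le> 2 * mf M \<rho>" using mst_le_2_mf[OF assms(1-3)] by blast
  then show ?thesis using mst_pos[OF assms] by (simp add: sgr_of_subset_def le_divide_eq)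
qed

lemma sgr_n_ge_half:
  assumes "Metric_space X \<rho>" "x \<in> X" "y \<in> X" "x \<noteq> y" "1 < n"
  shows "1 / 2 \<le> sgr_n n X \<rho>"
  unfolding sgr_n_def
proof (rule cINF_greatest)
  have "{x, y} \<in> {M. M \<subseteq> X \<and> finite M \<and> 1 < card M \<and> card M \<le> n}" using assms by simp
  then show "{M. M \<subseteq> X \<and> finite M \<and> 1 < card M \<and> card M \<le> n} \<noteq> {}" by blast
qed (use sgr_of_subset_ge_half[OF assms(1)] in auto)

lemma sgr_ge_half:
  assumes "Metric_space X \<rho>" "x \<in> X" "y \<in> X" "x \<noteq> y"
  shows "1 / 2 \<le> sgr X \<rho>"
  unfolding sgr_def
proof (rule cINF_greatest)
  show "{1 :: nat<..} \<noteq> {}" by auto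
  show "1 / 2 \<le> sgr_n n X \<rho>" if "n \<in> {1<..}" for n
    using sgr_n_ge_half[OF assms] that by simp
qed

lemma sgr_le_sgr_of_subset:
  assumes "Metric_space X \<rho>" "M \<subseteq> X" "finite M" "1 < card M"
  shows "sgr X \<rho> \<le> sgr_of_subset \<rho> M"
proof -
  obtain x y where xy: "x \<in> X" "y \<in> X" "x \<noteq> y"
    using assms(2-4) by (metis card_le_Suc0_iff_eq not_less One_nat_def subsetD)
  have "sgr X \<rho> \<le> sgr_n (card M) X \<rho>"
    unfolding sgr_def using sgr_n_ge_half[OF assms(1) xy] assms(4)
    by (intro cINF_lower bdd_belowI2[where m = "1 / 2"]) auto
  also have "\<dots> \<le> sgr_of_subset \<rho> M"
    unfolding sgr_n_def using sgr_of_subset_ge_half[OF assms(1)] assms(2-4)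
    by (intro cINF_lower bdd_belowI2[where m = "1 / 2"]) auto
  finally show ?thesis .
qed

section \<open>The discrete metric\<close>

text \<open>The metric in which any two distinct points have distance \<open>1\<close>.\<close>

definition discrete_dist :: "'a \<Rightarrow> 'a \<Rightarrow> real" where
  "discrete_dist x y = (if x = y then 0 else 1)"

lemma discrete_Metric_space: "Metric_space X discrete_dist"
  by unfold_locales (auto simp: discrete_dist_def)

lemma mst_discrete_ge:
  assumes "finite M" "M \<noteq> {}"
  shows "real (card M) - 1 \<le> mst M discrete_dist"
proof -
  obtain E where E: "is_tree M E" "mst M discrete_dist = (\<Sum>e\<in>E. edge_length discrete_dist e)"
    using mst_attained[OF assms] by blast
  have "edge_length discrete_dist e = 1" if e: "e \<in> E" for e :: "'a set"
  proof -
    obtain v w where "e = {v, w}" "v \<noteq> w" using tree_edge[OF E(1) e] by blast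
    then show ?thesis
      using edge_length_doubleton[of discrete_dist v w] by (auto simp: discrete_dist_def)
  qed
  then have "mst M discrete_dist = card E" using E(2) by simp
  then show ?thesis using tree_card_ge[OF E(1)] by simp
qed

lemma mf_discrete_le:
  assumes "finite M"
  shows "mf M discrete_dist \<le> card M / 2"
proof -
  have "\<exists>V E. is_filling M discrete_dist V E (\<lambda>_. 1 / 2) \<and>
      (\<Sum>e\<in>E. 1 / 2) = 1 / 2 * real (card M)"
    by (rule star_is_filling[OF assms]) (auto simp: discrete_dist_def)
  then obtain V E where VE: "is_filling M discrete_dist V E (\<lambda>_. 1 / 2)"
    "(\<Sum>e\<in>E. 1 / 2) = 1 / 2 * real (card M)"
    by blast
  have "mf M discrete_dist \<le> (\<Sum>e\<in>E. 1 / 2)"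
    unfolding mf_def
  proof (rule cInf_lower)
    show "bdd_below {\<Sum>e\<in>E. \<omega> e | V E \<omega>. is_filling M discrete_dist V E \<omega>}"
      by (rule bdd_belowI[where m = 0]) (auto simp: is_filling_def intro!: sum_nonneg)
  qed (use VE(1) in blast)
  then show ?thesis using VE(2) by simp
qed

lemma sgr_discrete: "sgr (UNIV :: nat set) discrete_dist = 1 / 2"
proof (rule antisym)
  have bound: "sgr (UNIV :: nat set) discrete_dist \<le> (real n + 2) / (2 * (real n + 1))" for n
  proof -
    let ?M = "{..<n + 2}"
    have "sgr (UNIV :: nat set) discrete_dist \<le> mf ?M discrete_dist / mst ?M discrete_dist"
      using sgr_le_sgr_of_subset[OF discrete_Metric_space, of ?M UNIV]
      unfolding sgr_of_subset_def by simp
    also have "\<dots> \<le> ((real n + 2) / 2) / (real n + 1)"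
    proof (rule frac_le)
      show "mf ?M discrete_dist \<le> (real n + 2) / 2"
        using mf_discrete_le[of ?M] by simp
      show "real n + 1 \<le> mst ?M discrete_dist"
        using mst_discrete_ge[of ?M] by (auto simp: lessThan_empty_iff)
    qed auto
    finally show ?thesis by (simp add: field_simps)
  qed
  have lim: "(\<lambda>n. (1 + 1 / real (Suc n)) / 2) \<longlonglongrightarrow> (1 + 0) / 2"
    using LIMSEQ_inverse_real_of_nat by (intro tendsto_intros) (auto simp: inverse_eq_divide)
  have eq: "(real n + 2) / (2 * (real n + 1)) = (1 + 1 / real (Suc n)) / 2" for n
    by (simp add: field_simps)
  have "(\<lambda>n. (real n + 2) / (2 * (real n + 1))) \<longlonglongrightarrow> 1 / 2"
    unfolding eq using lim by (simp only: add_0_right)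
  then show "sgr (UNIV :: nat set) discrete_dist \<le> 1 / 2"
    by (rule LIMSEQ_le_const) (use bound in blast)
  show "1 / 2 \<le> sgr (UNIV :: nat set) discrete_dist"
    by (rule sgr_ge_half[OF discrete_Metric_space, of 0 _ 1]) auto
qed

theorem mainTheorem15:
  shows "(\<forall>(X :: 'a set) \<rho>.
            Metric_space X \<rho> \<and> (\<exists>x\<in>X. \<exists>y\<in>X. x \<noteq> y) \<longrightarrow> sgr X \<rho> \<ge> 1 / 2) \<and>
         (\<exists>(Y :: nat set) \<sigma>.
            Metric_space Y \<sigma> \<and> (\<exists>x\<in>Y. \<exists>y\<in>Y. x \<noteq> y) \<and> sgr Y \<sigma> = 1 / 2)"
proof
  show "\<forall>(X :: 'a set) \<rho>.
      Metric_space X \<rho> \<and> (\<exists>x\<in>X. \<exists>y\<in>X. x \<noteq> y) \<longrightarrow> sgr X \<rho> \<ge> 1 / 2"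
    by (intro allI impI, elim conjE bexE) (rule sgr_ge_half)
  have "\<exists>x\<in>UNIV. \<exists>y\<in>UNIV. x \<noteq> (y :: nat)"
    by (rule bexI[of _ 0], rule bexI[of _ 1]) simp_all
  then show "\<exists>(Y :: nat set) \<sigma>.
      Metric_space Y \<sigma> \<and> (\<exists>x\<in>Y. \<exists>y\<in>Y. x \<noteq> y) \<and> sgr Y \<sigma> = 1 / 2"
    by (intro exI[of _ UNIV] exI[of _ discrete_dist] conjI discrete_Metric_space sgr_discrete)
qed

end
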